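(* Let $G=(V,E)$ be a finite simple graph with $\gamma(G)=k$, let $v\in V$, and let $X$ be a finite set of new vertices with $V\cap X=\emptyset$. Let $G'$ be any graph with vertex set $V\cup X$ whose induced subgraph on $V$ is $G$ and in which the vertices of $\{v\}\cup X$ are pairwise false twins, or pairwise true twins. Then $\gamma(G')\le k+1$.
   Context: All graphs are finite, simple and undirected. $N(u)$ denotes the neighbourhood of $u$. Distinct vertices $u,v$ are true twins if $N(u)\cup\{u\}=N(v)\cup\{v\}$ and false twins if $N(u)=N(v)$. A graph $G=(V,E)$ is a star-$k$-PCG if there exist a weight function $w:V\to\mathbb{R}^+$ and $k$ pairwise disjoint intervals $I_1,\dots,I_k$ such that for distinct $u,v\in V$, $uv\in E$ if and only if $w(u)+w(v)\in\bigcup_i I_i$. The star number $\gamma(G)$ is the least positive integer $k$ such that $G$ is a star-$k$-PCG. *)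

theory Defs
  imports "HOL-Analysis.Analysis" "Graph_Theory.Pair_Digraph" "Graph_Theory.Digraph_Component"
begin

text \<open>A finite simple undirected graph is a \<^const>\<open>pair_graph\<close>: a finite, loop-free
  digraph without parallel arcs whose arc relation is symmetric, so that an edge
  \<open>uv\<close> is represented by the two arcs \<open>(u, v)\<close> and \<open>(v, u)\<close>.\<close>

definition nbhd :: "'a pair_pre_digraph \<Rightarrow> 'a \<Rightarrow> 'a set" where
  "nbhd G u = {v. (u, v) \<in> parcs G}"

definition true_twins :: "'a pair_pre_digraph \<Rightarrow> 'a \<Rightarrow> 'a \<Rightarrow> bool" where
  "true_twins G u v \<longleftrightarrow> u \<in> pverts G \<and> v \<in> pverts G \<and> u \<noteq> v \<and>
     nbhd G u \<union> {u} = nbhd G v \<union> {v}"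

definition false_twins :: "'a pair_pre_digraph \<Rightarrow> 'a \<Rightarrow> 'a \<Rightarrow> bool" where
  "false_twins G u v \<longleftrightarrow> u \<in> pverts G \<and> v \<in> pverts G \<and> u \<noteq> v \<and> nbhd G u = nbhd G v"

text \<open>Intervals are nonempty, and may be open, closed, half-open, unbounded or a single point.\<close>

definition star_k_PCG :: "nat \<Rightarrow> 'a pair_pre_digraph \<Rightarrow> bool" where
  "star_k_PCG k G \<longleftrightarrow>
     (\<exists>(w :: 'a \<Rightarrow> real) (I :: nat \<Rightarrow> real set).
        (\<forall>u\<in>pverts G. w u > 0) \<and>
        (\<forall>i\<in>{1..k}. is_interval (I i) \<and> I i \<noteq> {}) \<and>
        disjoint_family_on I {1..k} \<and>
        (\<forall>u\<in>pverts G. \<forall>v\<in>pverts G. u \<noteq> v \<longrightarrow>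
           ((u, v) \<in> parcs G \<longleftrightarrow> w u + w v \<in> (\<Union>i\<in>{1..k}. I i))))"

text \<open>For a finite graph such a \<open>k\<close> always exists: choose weights for which distinct pairs of
  vertices have distinct weight sums, and one single-point interval for each edge.\<close>

definition star_number :: "'a pair_pre_digraph \<Rightarrow> nat" where
  "star_number G = (LEAST k. k \<ge> 1 \<and> star_k_PCG k G)"

end

theory Submission
  imports Defs
begin

text \<open>Give every new vertex the weight of \<open>v\<close>. The only sums this adds are equal to \<open>2 w(v)\<close>,
  and the twin type dictates whether this one value has to belong to the union of the intervals.
  Increasing \<open>w(v)\<close> slightly, and stretching the intervals to the right accordingly, makes
  \<open>2 w(v)\<close> different from all sums of two distinct vertices of the old graph. Then \<open>2 w(v)\<close> can be
  included or excluded freely, either by adding a singleton or by cutting one interval into two;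
  both cost at most one additional interval.\<close>

section \<open>Moving twice the weight of one vertex away from all sums of distinct vertices\<close>

text \<open>The finitely many positive differences have a positive minimum. The factor 2 is there
  because raising a weight by \<open>e\<close> raises its double by \<open>2 * e\<close>.\<close>

lemma exists_small_gap:
  fixes S :: "real set"
  assumes "finite S"
  obtains e where "e > 0" "\<And>s t. s \<in> S \<Longrightarrow> t \<in> S \<Longrightarrow> s < t \<Longrightarrow> 2 * e < t - s"
proof -
  \<comment> \<open>The element 1 keeps \<open>D\<close> nonempty when \<open>S\<close> has no two
    distinct points.\<close>
  define D where "D = insert 1 ((\<lambda>(s, t). t - s) ` {(s, t) \<in> S \<times> S. s < t})"
  have "finite {(s, t) \<in> S \<times> S. s < t}"
    by (rule finite_subset[of _ "S \<times> S"]) (use assms in auto)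
  then have D: "finite D" "D \<noteq> {}" by (auto simp: D_def)
  have pos: "Min D > 0" using D by (subst Min_gr_iff) (auto simp: D_def)
  show ?thesis
  proof
    show "Min D / 3 > 0" using pos by simp
    fix s t assume "s \<in> S" "t \<in> S" "s < t"
    then have "Min D \<le> t - s" using D by (intro Min_le) (auto simp: D_def)
    then show "2 * (Min D / 3) < t - s" using pos by linarith
  qed
qed

lemma is_interval_singleton_real [simp]: "is_interval {x::real}"
  by (simp add: is_interval_convex_1)

text \<open>The larger of \<open>s\<close> and \<open>s'\<close> would lie in both intervals. This
  is what keeps stretched intervals disjoint.\<close>

lemma intervals_disjoint_order:
  fixes A B :: "real set"
  assumes "is_interval A" "is_interval B" "A \<inter> B = {}"
    and "s \<in> A" "t \<in> A" "s' \<in> B" "t' \<in> B" "s \<le> t'" "s' \<le> t"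
  shows False
proof (cases "s' \<le> s")
  case True
  then have "s \<in> B" using assms by (meson mem_is_interval_1_I)
  then show False using assms by blast
next
  case False
  then have "s' \<in> A" using assms by (meson mem_is_interval_1_I less_imp_le not_le)
  then show False using assms by blast
qed

lemma separate_double_weight:
  fixes w :: "'a \<Rightarrow> real" and F :: "real set set"
  assumes V: "finite V" "v \<in> V" and w: "\<And>u. u \<in> V \<Longrightarrow> w u > 0"
    and F: "finite F" "\<And>J. J \<in> F \<Longrightarrow> is_interval J" "disjoint F"
  obtains w' :: "'a \<Rightarrow> real" and F' :: "real set set" where
    "\<And>u. u \<in> V \<Longrightarrow> w' u > 0"
    "finite F'" "card F' \<le> card F" "\<And>J. J \<in> F' \<Longrightarrow> is_interval J" "disjoint F'"
    "\<And>a b. a \<in> V \<Longrightarrow> b \<in> V \<Longrightarrow> a \<noteq> b \<Longrightarrow> w' a + w' b \<in> \<Union>F' \<longleftrightarrow> w a + w b \<in> \<Union>F"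
    "\<And>a b. a \<in> V \<Longrightarrow> b \<in> V \<Longrightarrow> a \<noteq> b \<Longrightarrow> w' a + w' b \<noteq> 2 * w' v"
proof -
  \<comment> \<open>Pairs with equal entries are included, because \<open>2 * w v\<close> is
    compared with the other sums at the end.\<close>
  define S where "S = (\<lambda>(a, b). w a + w b) ` (V \<times> V)"
  have S: "w a + w b \<in> S" if "a \<in> V" "b \<in> V" for a b
    using that by (force simp: S_def)
  have "finite S" using V by (simp add: S_def)
  then obtain e where e: "e > 0" "\<And>s t. s \<in> S \<Longrightarrow> t \<in> S \<Longrightarrow> s < t \<Longrightarrow> 2 * e < t - s"
    using exists_small_gap by blast
  have gap: "s \<le> t" if "s \<in> S" "t \<in> S" "s \<le> t + e" for s t
    using e(1) e(2)[of t s] that by force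
  \<comment> \<open>Only the span of the sums in \<open>J\<close> is stretched by \<open>e\<close>;
    stretching all of \<open>J\<close> could make it run into a neighbouring interval. The result is
    empty if \<open>J\<close> contains no sum.\<close>
  define stretch where
    "stretch J = {x. \<exists>s \<in> J \<inter> S. \<exists>t \<in> J \<inter> S. s \<le> x \<and> x \<le> t + e}" for J
  define w' where "w' = w(v := w v + e)"
  show ?thesis
  proof
    show "w' u > 0" if "u \<in> V" for u using w[OF that] e(1) by (auto simp: w'_def)
    show "finite (stretch ` F)" "card (stretch ` F) \<le> card F"
      using F by (auto intro: card_image_le)
    show "is_interval J" if "J \<in> stretch ` F" for J
    proof -
      obtain K where "J = stretch K" using \<open>J \<in> stretch ` F\<close> by blast
      then show ?thesis
        unfolding is_interval_1 by (simp add: stretch_def) (meson order_trans)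
    qed
    show "disjoint (stretch ` F)"
    proof (rule disjointI)
      fix A B assume "A \<in> stretch ` F" "B \<in> stretch ` F" "A \<noteq> B"
      then obtain J K where JK: "J \<in> F" "K \<in> F" "J \<noteq> K" "A = stretch J" "B = stretch K"
        by blast
      have disj: "J \<inter> K = {}" using JK F(3) by (meson disjointD)
      have False if x: "x \<in> A" "x \<in> B" for x
      proof -
        obtain s t where st: "s \<in> J" "t \<in> J" "s \<in> S" "t \<in> S" "s \<le> x" "x \<le> t + e"
          using x(1) unfolding JK(4) stretch_def by blast
        obtain s' t' where st': "s' \<in> K" "t' \<in> K" "s' \<in> S" "t' \<in> S" "s' \<le> x" "x \<le> t' + e"
          using x(2) unfolding JK(5) stretch_def by blast
        have "s \<le> t'" "s' \<le> t"
          using gap[of s t'] gap[of s' t] st st' by auto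
        then show False
          using intervals_disjoint_order[OF F(2) F(2) disj] JK st st' by blast
      qed
      then show "A \<inter> B = {}" by blast
    qed
    show "w' a + w' b \<in> \<Union>(stretch ` F) \<longleftrightarrow> w a + w b \<in> \<Union>F"
      if ab: "a \<in> V" "b \<in> V" "a \<noteq> b" for a b
    proof -
      \<comment> \<open>At most one of \<open>a\<close> and \<open>b\<close> is \<open>v\<close>, so
        the sum moves by 0 or \<open>e\<close>.\<close>
      have range: "w a + w b \<le> w' a + w' b" "w' a + w' b \<le> (w a + w b) + e"
        using ab e(1) by (auto simp: w'_def)
      show ?thesis
      proof
        assume "w a + w b \<in> \<Union>F"
        then show "w' a + w' b \<in> \<Union>(stretch ` F)"
          using range S[OF ab(1,2)] by (auto simp: stretch_def)
      next
        assume "w' a + w' b \<in> \<Union>(stretch ` F)"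
        then obtain J s t where J: "J \<in> F" "s \<in> J" "t \<in> J" "s \<in> S" "t \<in> S"
            "s \<le> w' a + w' b" "w' a + w' b \<le> t + e"
          by (auto simp: stretch_def)
        have "s \<le> w a + w b" "w a + w b \<le> t"
          using gap[of s "w a + w b"] gap[of "w a + w b" t] J S[OF ab(1,2)] range by auto
        then show "w a + w b \<in> \<Union>F"
          using J F(2) by (meson UnionI mem_is_interval_1_I)
      qed
    qed
    show "w' a + w' b \<noteq> 2 * w' v" if ab: "a \<in> V" "b \<in> V" "a \<noteq> b" for a b
    proof
      assume eq: "w' a + w' b = 2 * w' v"
      \<comment> \<open>The first case is that \<open>v\<close> is one of the two vertices, the
        second that it is neither. Both put two points of \<open>S\<close> at a positive distance of
        at most \<open>2 * e\<close>.\<close>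
      have "w a + w b = 2 * w v + e \<or> w a + w b = 2 * w v + 2 * e"
        using eq ab by (auto simp: w'_def split: if_splits)
      then show False
        using e(2)[of "w v + w v" "w a + w b"] S[OF ab(1,2)] S[OF V(2) V(2)] e(1) by auto
    qed
  qed
qed

section \<open>Passing between indexed families and finite sets of intervals\<close>

text \<open>Missing or empty intervals are replaced by single points beyond all weight sums.\<close>

lemma star_k_PCG_I:
  fixes w :: "'a \<Rightarrow> real" and F :: "real set set"
  assumes fin: "finite (pverts G)" and w: "\<And>u. u \<in> pverts G \<Longrightarrow> w u > 0"
    and F: "finite F" "card F \<le> k" "\<And>J. J \<in> F \<Longrightarrow> is_interval J" "disjoint F"
    and adj: "\<And>u v. u \<in> pverts G \<Longrightarrow> v \<in> pverts G \<Longrightarrow> u \<noteq> v \<Longrightarrow>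
      (u, v) \<in> parcs G \<longleftrightarrow> w u + w v \<in> \<Union>F"
  shows "star_k_PCG k G"
proof -
  define S where "S = (\<lambda>(a, b). w a + w b) ` (pverts G \<times> pverts G)"
  have "finite S" using fin by (simp add: S_def)
  then obtain M where "\<And>s. s \<in> S \<Longrightarrow> s \<le> M"
    using bdd_above_finite[of S] by (auto simp: bdd_above_def)
  then have M: "w u + w v \<le> M" if "u \<in> pverts G" "v \<in> pverts G" for u v
    using that by (force simp: S_def)
  obtain h where h: "bij_betw h {1..card F} F"
    using ex_bij_betw_nat_finite_1[OF F(1)] by blast
  \<comment> \<open>Cutting at \<open>M\<close> loses no weight sum and frees the half-line beyond
    \<open>M\<close> for padding.\<close>
  define K where "K i = (if i \<le> card F then h i \<inter> {..M} else {})" for i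
  \<comment> \<open>Indices start at 1, so the padding points lie strictly beyond \<open>M\<close>
    and are distinct.\<close>
  define I where "I i = (if K i = {} then {M + real i} else K i)" for i
  have hF: "h i \<in> F" if "i \<in> {1..card F}" for i using h that by (auto simp: bij_betw_def)
  have "is_interval (K i)" if "i \<ge> 1" for i
    using that F(3) hF by (auto simp: K_def intro!: is_interval_Int)
  then have int: "\<forall>i\<in>{1..k}. is_interval (I i) \<and> I i \<noteq> {}"
    by (auto simp: I_def)
  have KK: "K i \<inter> K j = {}" if "i \<ge> 1" "j \<ge> 1" "i \<noteq> j" for i j
  proof (cases "i \<le> card F \<and> j \<le> card F")
    case True
    then have "h i \<noteq> h j"
      using bij_betw_imp_inj_on[OF h] that by (auto dest: inj_onD)
    then have "h i \<inter> h j = {}" using F(4) hF True that by (intro disjointD) auto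
    then show ?thesis by (auto simp: K_def)
  qed (auto simp: K_def)
  have KM: "x \<le> M" if "x \<in> K i" for x i using that by (auto simp: K_def split: if_splits)
  have disj: "disjoint_family_on I {1..k}"
    unfolding disjoint_family_on_def
  proof (intro ballI impI)
    fix i j assume ij: "i \<in> {1..k}" "j \<in> {1..k}" "i \<noteq> j"
    show "I i \<inter> I j = {}"
      using KK[of i j] ij KM[of "M + real i" j] KM[of "M + real j" i] by (auto simp: I_def)
  qed
  have "w u + w v \<in> (\<Union>i\<in>{1..k}. I i) \<longleftrightarrow> w u + w v \<in> \<Union>F"
    if uv: "u \<in> pverts G" "v \<in> pverts G" for u v
  proof
    assume "w u + w v \<in> (\<Union>i\<in>{1..k}. I i)"
    then obtain i where i: "i \<in> {1..k}" "w u + w v \<in> I i" by blast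
    have "w u + w v \<in> K i" using i M[OF uv] by (auto simp: I_def split: if_splits)
    then show "w u + w v \<in> \<Union>F" using hF[of i] i by (auto simp: K_def split: if_splits)
  next
    assume "w u + w v \<in> \<Union>F"
    then obtain i where i: "i \<in> {1..card F}" "w u + w v \<in> h i"
      using bij_betw_imp_surj_on[OF h] by blast
    then have "w u + w v \<in> K i" using M[OF uv] by (auto simp: K_def)
    then have "w u + w v \<in> I i" by (auto simp: I_def)
    then show "w u + w v \<in> (\<Union>i\<in>{1..k}. I i)" using i F(2) by auto
  qed
  then show ?thesis
    unfolding star_k_PCG_def using w int disj adj by (intro exI[of _ w] exI[of _ I]) auto
qed

text \<open>Sets of at most \<open>k\<close> possibly empty intervals are easier to modify than
  families of exactly \<open>k\<close> nonempty ones; \<open>star_k_PCG_I\<close> leads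
  back.\<close>

lemma star_k_PCG_E:
  assumes "star_k_PCG k G"
  obtains w :: "'a \<Rightarrow> real" and F :: "real set set" where
    "\<And>u. u \<in> pverts G \<Longrightarrow> w u > 0"
    "finite F" "card F \<le> k" "\<And>J. J \<in> F \<Longrightarrow> is_interval J" "disjoint F"
    "\<And>u v. u \<in> pverts G \<Longrightarrow> v \<in> pverts G \<Longrightarrow> u \<noteq> v \<Longrightarrow>
      (u, v) \<in> parcs (G :: 'a pair_pre_digraph) \<longleftrightarrow> w u + w v \<in> \<Union>F"
proof -
  obtain w I where wI: "\<forall>u\<in>pverts G. w u > (0 :: real)"
      "\<forall>i\<in>{1..k}. is_interval (I i) \<and> I i \<noteq> ({} :: real set)"
      "disjoint_family_on I {1..k}"
      "\<forall>u\<in>pverts G. \<forall>v\<in>pverts G. u \<noteq> v \<longrightarrow>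
         ((u, v) \<in> parcs G \<longleftrightarrow> w u + w v \<in> (\<Union>i\<in>{1..k}. I i))"
    using assms unfolding star_k_PCG_def by blast
  show ?thesis
  proof (rule that[of w "I ` {1..k}"])
    show "card (I ` {1..k}) \<le> k" using card_image_le[of "{1..k}" I] by simp
    show "disjoint (I ` {1..k})" using wI(3) by (rule disjoint_family_on_disjoint_image)
  qed (use wI in auto)
qed

section \<open>Existence of a star representation for every finite graph\<close>

text \<open>A sum of two powers is at most twice the larger one, and base 3 makes this strictly less
  than the next power.\<close>

lemma power3_sum_eq_imp_max_le:
  fixes a b c d :: nat
  assumes "(3::real) ^ a + 3 ^ b = 3 ^ c + 3 ^ d"
  shows "max a b \<le> max c d"
proof (rule ccontr)
  assume "\<not> ?thesis"
  then have "Suc (max c d) \<le> max a b" by linarith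
  then have "(3::real) ^ Suc (max c d) \<le> 3 ^ max a b" by (intro power_increasing) auto
  also have "\<dots> \<le> 3 ^ a + 3 ^ b" by (auto simp: max_def)
  also have "\<dots> = 3 ^ c + 3 ^ d" by (rule assms)
  also have "\<dots> \<le> 3 ^ max c d + 3 ^ max c d"
    by (intro add_mono power_increasing) auto
  also have "\<dots> < 3 ^ Suc (max c d)" by simp
  finally show False by simp
qed

text \<open>The larger exponents on the two sides agree, and cancelling that common power leaves the
  other two equal.\<close>

lemma power3_sum_eq_iff:
  fixes a b c d :: nat
  shows "(3::real) ^ a + 3 ^ b = 3 ^ c + 3 ^ d \<longleftrightarrow> (a = c \<and> b = d) \<or> (a = d \<and> b = c)"
proof
  assume eq: "(3::real) ^ a + 3 ^ b = 3 ^ c + 3 ^ d"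
  have "max a b = max c d"
    using power3_sum_eq_imp_max_le[OF eq] power3_sum_eq_imp_max_le[OF eq[symmetric]] by linarith
  then have "a = c \<or> a = d \<or> b = c \<or> b = d" by (auto simp: max_def split: if_splits)
  then show "(a = c \<and> b = d) \<or> (a = d \<and> b = c)" using eq by auto
qed auto

text \<open>This guarantees that the \<open>LEAST\<close> in \<open>star_number\<close> is
  attained.\<close>

lemma pair_graph_exists_star_k_PCG:
  assumes "pair_graph G"
  shows "\<exists>k \<ge> 1. star_k_PCG k G"
proof -
  interpret pair_graph G by (rule assms)
  obtain f :: "'a \<Rightarrow> nat" where f: "inj_on f (pverts G)"
    using finite_imp_inj_to_nat_seg[OF finite_verts] by auto
  \<comment> \<open>With powers of 3 along an injective numbering, a sum determines its unordered
    pair of vertices.\<close>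
  define w where "w u = (3::real) ^ f u" for u
  define F where "F = (\<lambda>(u, v). {w u + w v}) ` parcs G"
  have "finite F" by (simp add: F_def)
  \<comment> \<open>The successor keeps the number of intervals positive when there are no
    edges.\<close>
  have "star_k_PCG (Suc (card F)) G"
  proof (rule star_k_PCG_I)
    show "disjoint F" by (auto simp: F_def pairwise_def disjnt_def)
    show "(u, v) \<in> parcs G \<longleftrightarrow> w u + w v \<in> \<Union>F"
      if uv: "u \<in> pverts G" "v \<in> pverts G" "u \<noteq> v" for u v
    proof
      assume "w u + w v \<in> \<Union>F"
      then obtain a b where ab: "(a, b) \<in> parcs G" "w u + w v = w a + w b"
        by (auto simp: F_def)
      have "a \<in> pverts G" "b \<in> pverts G" using ab(1) in_arcsD1 in_arcsD2 by auto
      then have "(u = a \<and> v = b) \<or> (u = b \<and> v = a)"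
        using ab(2) f uv unfolding w_def power3_sum_eq_iff inj_on_def by metis
      then show "(u, v) \<in> parcs G" using ab(1) arcs_symmetric by blast
    qed (force simp: F_def)
  qed (use \<open>finite F\<close> in \<open>auto simp: w_def F_def\<close>)
  then show ?thesis by auto
qed

lemma star_k_PCG_star_number:
  assumes "pair_graph G"
  shows "star_k_PCG (star_number G) G"
  using LeastI_ex[OF pair_graph_exists_star_k_PCG[OF assms]]
  unfolding star_number_def by auto

lemma star_number_le: "k \<ge> 1 \<Longrightarrow> star_k_PCG k G \<Longrightarrow> star_number G \<le> k"
  unfolding star_number_def by (rule Least_le) simp

section \<open>Including or excluding a single value\<close>

text \<open>\<open>P\<close> is arbitrary so that both twin types are covered: true twins need
  \<open>c\<close> in the union, false twins need it outside.\<close>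

lemma intervals_adjust_point:
  fixes F :: "real set set" and c :: real
  assumes F: "finite F" "\<And>J. J \<in> F \<Longrightarrow> is_interval J" "disjoint F"
  obtains F' where "finite F'" "card F' \<le> card F + 1" "\<And>J. J \<in> F' \<Longrightarrow> is_interval J"
    "disjoint F'" "\<And>x. x \<noteq> c \<Longrightarrow> x \<in> \<Union>F' \<longleftrightarrow> x \<in> \<Union>F" "c \<in> \<Union>F' \<longleftrightarrow> P"
proof -
  consider "c \<in> \<Union>F \<longleftrightarrow> P" | "c \<notin> \<Union>F" P | "c \<in> \<Union>F" "\<not> P" by blast
  then show ?thesis
  proof cases
    case 1
    then show ?thesis using F by (intro that[of F]) auto
  next
    case 2
    show ?thesis
    proof (rule that[of "insert {c} F"])
      show "card (insert {c} F) \<le> card F + 1" using card_insert_le_m1[of "card F + 1" F] by simp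
      show "disjoint (insert {c} F)"
        using F(3) 2 by (auto simp: pairwise_insert disjnt_def)
    qed (use F 2 in auto)
  next
    case 3
    then obtain J where J: "J \<in> F" "c \<in> J" by blast
    have other: "K \<inter> J = {}" if "K \<in> F - {J}" for K
      using that J F(3) by (auto dest: disjointD)
    \<comment> \<open>Two pieces replace \<open>J\<close>, hence one extra member at most. A piece
      is empty when \<open>c\<close> is the corresponding endpoint of \<open>J\<close>.\<close>
    let ?F' = "insert (J \<inter> {..<c}) (insert (J \<inter> {c<..}) (F - {J}))"
    show ?thesis
    proof (rule that[of ?F'])
      have "card ?F' \<le> Suc (Suc (card (F - {J})))"
        using F(1) by (simp add: card_insert_if)
      then show "card ?F' \<le> card F + 1" using J F(1) card_Suc_Diff1[of F J] by simp
      show "is_interval K" if "K \<in> ?F'" for K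
        using that F(2) J by (auto intro!: is_interval_Int)
      have "disjoint (F - {J})" using F(3) by (rule pairwise_subset) auto
      then show "disjoint ?F'"
        using other by (fastforce simp: pairwise_insert disjnt_def)
      show "x \<in> \<Union>?F' \<longleftrightarrow> x \<in> \<Union>F" if "x \<noteq> c" for x
        using that J by auto
      show "c \<in> \<Union>?F' \<longleftrightarrow> P" using 3 J other by auto
    qed (use F in auto)
  qed
qed

section \<open>Adjacency of twins\<close>

text \<open>An arc from \<open>x\<close> to \<open>y\<close> would put \<open>y\<close> into its own
  neighbourhood, giving a loop.\<close>

lemma false_twins_not_adjacent:
  assumes "pair_graph G" "false_twins G x y"
  shows "(x, y) \<notin> parcs G"
proof -
  interpret pair_graph G by (rule assms(1))
  show ?thesis using assms(2) no_loops[of "(y, y)"] by (auto simp: false_twins_def nbhd_def)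
qed

lemma true_twins_adjacent: "true_twins G x y \<Longrightarrow> (x, y) \<in> parcs G"
  by (auto simp: true_twins_def nbhd_def)

text \<open>For either type, the two neighbourhoods can differ only in \<open>x\<close> and
  \<open>y\<close> themselves.\<close>

lemma twins_adjacent_iff:
  assumes "false_twins G x y \<or> true_twins G x y" "u \<noteq> x" "u \<noteq> y"
  shows "(x, u) \<in> parcs G \<longleftrightarrow> (y, u) \<in> parcs G"
  using assms by (auto simp: false_twins_def true_twins_def nbhd_def)

section \<open>Weights and intervals for the enlarged graph\<close>

theorem theorem5:
  fixes G G' :: "'a pair_pre_digraph" and v :: 'a and X :: "'a set" and k :: nat
  assumes "pair_graph G"
    and "star_number G = k"
    and "v \<in> pverts G"
    and "finite X"
    and "pverts G \<inter> X = {}"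
    and "pair_graph G'"
    and "pverts G' = pverts G \<union> X"
    and "with_proj G' \<restriction> pverts G = with_proj G"
    and "pairwise (false_twins G') ({v} \<union> X) \<or> pairwise (true_twins G') ({v} \<union> X)"
  shows "star_number G' \<le> k + 1"
proof -
  interpret G: pair_graph G by (rule assms(1))
  interpret G': pair_graph G' by (rule assms(6))
  have induced: "(a, b) \<in> parcs G' \<longleftrightarrow> (a, b) \<in> parcs G" if "a \<in> pverts G" "b \<in> pverts G" for a b
    using arg_cong[OF assms(8), of "\<lambda>H. (a, b) \<in> arcs H"] that by simp
  have finG: "finite (pverts G)" using G.finite_verts by simp
  \<comment> \<open>\<open>P\<close> decides whether \<open>2 * w1 v\<close> must be covered. If
    \<open>X\<close> is empty it holds vacuously, which is harmless since then no two vertices share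
    a representative.\<close>
  define P where "P \<longleftrightarrow> pairwise (true_twins G') ({v} \<union> X)"
  \<comment> \<open>The map \<open>p\<close> collapses the twin class to \<open>v\<close>, and each
    vertex will take the weight of its image.\<close>
  define p where "p u = (if u \<in> X then v else u)" for u
  have p: "p u \<in> pverts G" if "u \<in> pverts G'" for u
    using that assms(3,7) by (auto simp: p_def)
  have twins: "false_twins G' x y \<or> true_twins G' x y" if "x \<in> {v} \<union> X" "y \<in> {v} \<union> X" "x \<noteq> y" for x y
    using assms(9) that by (auto simp: pairwise_def)
  have p_eq: "u \<in> {v} \<union> X \<and> u' \<in> {v} \<union> X" if "p u = p u'" "u \<noteq> u'" for u u'
    using that by (auto simp: p_def split: if_splits)
  have same: "(u, u') \<in> parcs G' \<longleftrightarrow> P" if "p u = p u'" "u \<noteq> u'" for u u'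
    using p_eq[OF that] assms(9) that false_twins_not_adjacent[OF assms(6), of u u']
      true_twins_adjacent[of G' u u'] unfolding P_def pairwise_def by blast
  \<comment> \<open>Differing images mean that \<open>u'\<close> lies outside the twin class
    whenever \<open>u\<close> is in it, so \<open>u\<close> may be exchanged for
    \<open>v\<close>.\<close>
  have left: "(u, u') \<in> parcs G' \<longleftrightarrow> (p u, u') \<in> parcs G'" if "p u \<noteq> p u'" for u u'
    using twins_adjacent_iff[of G' u v u'] twins[of u v] that
    by (cases "u = v") (auto simp: p_def split: if_splits)
  have pp: "p (p u) = p u" for u using assms(3,5) by (auto simp: p_def)
  \<comment> \<open>Both endpoints are replaced in turn, using symmetry, until the pair lies in
    \<open>G\<close>.\<close>
  have diff: "(u, u') \<in> parcs G' \<longleftrightarrow> (p u, p u') \<in> parcs G"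
    if "u \<in> pverts G'" "u' \<in> pverts G'" "p u \<noteq> p u'" for u u'
    using left[of u u'] left[of u' "p u"] G'.arcs_symmetric induced[OF p p] that pp by metis
  obtain w F where wF: "\<And>u. u \<in> pverts G \<Longrightarrow> w u > (0::real)"
    "finite F" "card F \<le> k" "\<And>J. J \<in> F \<Longrightarrow> is_interval J" "disjoint F"
    "\<And>a b. a \<in> pverts G \<Longrightarrow> b \<in> pverts G \<Longrightarrow> a \<noteq> b \<Longrightarrow> (a, b) \<in> parcs G \<longleftrightarrow> w a + w b \<in> \<Union>F"
    using star_k_PCG_E star_k_PCG_star_number[OF assms(1)] assms(2) by metis
  obtain w1 F1 where w1: "\<And>u. u \<in> pverts G \<Longrightarrow> w1 u > (0::real)"
    and F1: "finite F1" "card F1 \<le> card F" "\<And>J. J \<in> F1 \<Longrightarrow> is_interval J" "disjoint F1"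
    and adj1: "\<And>a b. a \<in> pverts G \<Longrightarrow> b \<in> pverts G \<Longrightarrow> a \<noteq> b \<Longrightarrow>
      w1 a + w1 b \<in> \<Union>F1 \<longleftrightarrow> w a + w b \<in> \<Union>F"
    and ne1: "\<And>a b. a \<in> pverts G \<Longrightarrow> b \<in> pverts G \<Longrightarrow> a \<noteq> b \<Longrightarrow> w1 a + w1 b \<noteq> 2 * w1 v"
    using separate_double_weight[where w = w and F = F, OF finG assms(3) wF(1,2,4,5)] by blast
  obtain F2 where F2: "finite F2" "card F2 \<le> card F1 + 1" "\<And>J. J \<in> F2 \<Longrightarrow> is_interval J"
    "disjoint F2" "\<And>x. x \<noteq> 2 * w1 v \<Longrightarrow> x \<in> \<Union>F2 \<longleftrightarrow> x \<in> \<Union>F1" "2 * w1 v \<in> \<Union>F2 \<longleftrightarrow> P"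
    using intervals_adjust_point[OF F1(1,3,4), of "2 * w1 v" P] by blast
  have "star_k_PCG (k + 1) G'"
  proof (rule star_k_PCG_I[where w = "\<lambda>u. w1 (p u)" and F = F2])
    show "card F2 \<le> k + 1" using F2(2) F1(2) wF(3) by linarith
    show "(u, u') \<in> parcs G' \<longleftrightarrow> w1 (p u) + w1 (p u') \<in> \<Union>F2"
      if u: "u \<in> pverts G'" "u' \<in> pverts G'" "u \<noteq> u'" for u u'
    proof (cases "p u = p u'")
      case True
      have "p u = v" "p u' = v" using p_eq[OF True u(3)] by (auto simp: p_def)
      then show ?thesis using same[OF True u(3)] F2(6) by simp
    next
      case False
      \<comment> \<open>By \<open>ne1\<close> this sum avoids \<open>2 * w1 v\<close>, the only
        value where \<open>F2\<close> and \<open>F1\<close> may disagree.\<close>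
      then show ?thesis
        using diff[OF u(1,2)] F2(5) ne1 adj1 wF(6) p u by metis
    qed
  qed (use F2 w1 p in auto)
  then show ?thesis by (intro star_number_le) auto
qed

end
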